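(* Let $\mathbb{G}$ be a finite reflexive digraph. Suppose there exist a finite reflexive digraph $\mathbb{K}$ and vertices $x_1,\dots,x_k,u$ of $\mathbb{K}$ such that: (1) for every $a \in G$ there exists a map $f_a:\{x_1,\dots,x_k\}\to G$ such that $(\mathbb{K},f_a,u)$ pp-defines $G \setminus \{a\}$; (2) for every map $f:\{x_1,\dots,x_k\}\to G$, the set pp-defined by $(\mathbb{K},f,u)$ is a proper subset of $G$. Then $\mathbb{G}$ is S\l upecki.
   Context: All digraphs are finite and reflexive. For a digraph $\mathbb{K}$, vertices $x_1,\dots,x_k,u$ of $\mathbb{K}$ and a map $f:\{x_1,\dots,x_k\}\to G$, the set pp-defined by $(\mathbb{K},f,u)$ is $\{g(u) : g:\mathbb{K}\to\mathbb{G} \text{ a homomorphism with } g(x_i)=f(x_i) \text{ for all } i\}$. A $k$-ary polymorphism is a homomorphism $\mathbb{G}^k\to\mathbb{G}$ from the product digraph; it is essentially unary if it equals $(y_1,\dots,y_k)\mapsto h(y_i)$ for some $i$ and homomorphism $h:\mathbb{G}\to\mathbb{G}$. $\mathbb{G}$ is S\l upecki if for every $k\geq 2$ every surjective $k$-ary polymorphism is essentially unary.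
   Formalization: The formal theorem assumes in addition that G does not have exactly two vertices; for |G| = 2 the statement fails, since with K a single vertex x_1 = u both (1) and (2) hold, while no two-vertex reflexive digraph is Słupecki. *)

theory Defs
  imports "Graph_Theory.Pair_Digraph" "HOL-Library.FuncSet"
begin

locale reflexive_digraph = pair_fin_digraph G for G :: "'a pair_pre_digraph" +
  assumes reflexive: "refl_on (pverts G) (parcs G)"

definition dg_hom :: "'a pair_pre_digraph \<Rightarrow> 'b pair_pre_digraph \<Rightarrow> ('a \<Rightarrow> 'b) \<Rightarrow> bool" where
  "dg_hom H G g \<longleftrightarrow>
     g \<in> pverts H \<rightarrow> pverts G \<and> (\<forall>(x, y) \<in> parcs H. (g x, g y) \<in> parcs G)"

text \<open>Only the values of \<open>f\<close> on \<open>set xs\<close> matter: it stands for a map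
  \<open>{x\<^sub>1, \<dots>, x\<^sub>k} \<rightarrow> G\<close>.\<close>

definition pp_defined ::
    "'a pair_pre_digraph \<Rightarrow> 'b pair_pre_digraph \<Rightarrow> 'b list \<Rightarrow> ('b \<Rightarrow> 'a) \<Rightarrow> 'b \<Rightarrow> 'a set" where
  "pp_defined G K xs f u = {g u | g. dg_hom K G g \<and> (\<forall>x \<in> set xs. g x = f x)}"

text \<open>Elements of \<open>G\<^sup>k\<close> are functions on \<open>{..<k}\<close>, extensional so that
  each tuple has exactly one representative.\<close>

definition dg_power :: "'a pair_pre_digraph \<Rightarrow> nat \<Rightarrow> (nat \<Rightarrow> 'a) pair_pre_digraph" where
  "dg_power G k =
     \<lparr> pverts = {..<k} \<rightarrow>\<^sub>E pverts G,
       parcs = {(y, z). y \<in> {..<k} \<rightarrow>\<^sub>E pverts G \<and> z \<in> {..<k} \<rightarrow>\<^sub>E pverts G \<and>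
                        (\<forall>i<k. (y i, z i) \<in> parcs G)} \<rparr>"

definition polymorphism :: "'a pair_pre_digraph \<Rightarrow> nat \<Rightarrow> ((nat \<Rightarrow> 'a) \<Rightarrow> 'a) \<Rightarrow> bool" where
  "polymorphism G k F \<longleftrightarrow> dg_hom (dg_power G k) G F"

definition essentially_unary ::
    "'a pair_pre_digraph \<Rightarrow> nat \<Rightarrow> ((nat \<Rightarrow> 'a) \<Rightarrow> 'a) \<Rightarrow> bool" where
  "essentially_unary G k F \<longleftrightarrow>
     (\<exists>i<k. \<exists>h. dg_hom G G h \<and> (\<forall>y \<in> pverts (dg_power G k). F y = h (y i)))"

definition slupecki :: "'a pair_pre_digraph \<Rightarrow> bool" where
  "slupecki G \<longleftrightarrow>
     (\<forall>k\<ge>2. \<forall>F. polymorphism G k F \<and> F ` pverts (dg_power G k) = pverts G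
        \<longrightarrow> essentially_unary G k F)"

text \<open>Two-element digraphs have to be excluded from the theorem. Taking for \<open>K\<close> a single vertex
  \<open>x\<^sub>1 = u\<close>, the pp-defined sets are exactly the singletons, so both hypotheses hold for every
  digraph with two vertices, whereas the complete one admits conjunction as a polymorphism.\<close>

lemma two_element_counterexample:
  defines "G \<equiv> \<lparr> pverts = (UNIV :: bool set), parcs = UNIV \<rparr>"
    and "K \<equiv> \<lparr> pverts = (UNIV :: unit set), parcs = UNIV \<rparr>"
  shows "reflexive_digraph G" "reflexive_digraph K"
    and "\<forall>a \<in> pverts G. \<exists>f \<in> set [()] \<rightarrow> pverts G. pp_defined G K [()] f () = pverts G - {a}"
    and "\<forall>f \<in> set [()] \<rightarrow> pverts G. pp_defined G K [()] f () \<subset> pverts G"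
    and "\<not> slupecki G"
proof -
  show "reflexive_digraph G" "reflexive_digraph K"
    by (unfold_locales; simp add: G_def K_def refl_on_def)+
  have V: "pverts G = UNIV"
    by (simp add: G_def)
  have pp: "pp_defined G K [()] f () = {f ()}" for f
    by (auto simp: pp_defined_def dg_hom_def G_def K_def)
  show "\<forall>a \<in> pverts G. \<exists>f \<in> set [()] \<rightarrow> pverts G. pp_defined G K [()] f () = pverts G - {a}"
  proof
    fix a
    show "\<exists>f \<in> set [()] \<rightarrow> pverts G. pp_defined G K [()] f () = pverts G - {a}"
      by (rule bexI[of _ "\<lambda>_. \<not> a"]) (auto simp: pp V)
  qed
  show "\<forall>f \<in> set [()] \<rightarrow> pverts G. pp_defined G K [()] f () \<subset> pverts G"
    by (auto simp: pp V UNIV_bool)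
  show "\<not> slupecki G"
  proof
    assume sl: "slupecki G"
    define F where "F = (\<lambda>y :: nat \<Rightarrow> bool. y 0 \<and> y 1)"
    define t where "t = (\<lambda>a b. \<lambda>i\<in>{..<2::nat}. if i = 0 then a else b :: bool)"
    have t: "t a b \<in> pverts (dg_power G 2)" "F (t a b) = (a \<and> b)" "t a b 0 = a" "t a b 1 = b" for a b
      by (auto simp: t_def dg_power_def G_def F_def)
    have "polymorphism G 2 F"
      by (auto simp: polymorphism_def dg_hom_def G_def)
    moreover have "F ` pverts (dg_power G 2) = pverts G"
    proof -
      have "c \<in> F ` pverts (dg_power G 2)" for c
        by (rule image_eqI[OF _ t(1)[of c c]]) (simp add: t(2))
      then show ?thesis by (auto simp: V)
    qed
    ultimately have "essentially_unary G 2 F"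
      using sl by (simp add: slupecki_def)
    then obtain i h where "i < 2" and h: "\<And>y. y \<in> pverts (dg_power G 2) \<Longrightarrow> F y = h (y i)"
      by (auto simp: essentially_unary_def)
    then have "i = 0 \<or> i = 1" by auto
    then show False
      using h[OF t(1)[of True True]] h[OF t(1)[of True False]] h[OF t(1)[of False True]]
      by (auto simp: t simp del: One_nat_def)
  qed
qed

end

theory Submission
  imports Defs
begin

text \<open>
  Applying a polymorphism \<open>F\<close> to \<open>k\<close> homomorphisms \<open>K \<rightarrow> G\<close> shows that \<open>F\<close> maps the product of the
  sets pp-defined by \<open>f\<^sub>1, \<dots>, f\<^sub>k\<close> into the set pp-defined by \<open>F(f\<^sub>1, \<dots>, f\<^sub>k)\<close>. By the two
  hypotheses, \<open>F\<close> is therefore not onto on any box \<open>\<Prod>\<^sub>i (G - {a\<^sub>i})\<close>. On the other hand, by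
  Yablonskii's lemma, a surjective operation on a finite set with at least three elements that
  depends on two of its arguments is already onto on such a box: there are three arguments with
  distinct values that use at most two elements in every coordinate, and a preimage for each of the
  remaining \<open>n - 3\<close> values adds at most \<open>n - 3\<close> elements to every coordinate.
\<close>

text \<open>The coordinates of \<open>y\<close> are replaced by those of \<open>z\<close> one at a
  time, and no replacement changes the value. In the induction, \<open>J\<close> is the set of
  coordinates already replaced.\<close>

lemma constant_if_independent_of_each_coordinate:
  assumes "finite I"
    and upd: "\<And>y i a. y \<in> I \<rightarrow>\<^sub>E A \<Longrightarrow> i \<in> I \<Longrightarrow> a \<in> A \<Longrightarrow> F (y(i := a)) = F y"
    and y: "y \<in> I \<rightarrow>\<^sub>E A" and z: "z \<in> I \<rightarrow>\<^sub>E A"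
  shows "F y = F z"
proof -
  have "F (\<lambda>i. if i \<in> J then z i else y i) = F y" if "finite J" "J \<subseteq> I" for J
    using that
  proof (induction J rule: finite_induct)
    case (insert j J)
    let ?w = "\<lambda>i. if i \<in> J then z i else y i"
    have "?w \<in> I \<rightarrow>\<^sub>E A"
      using y z by (auto simp: PiE_iff extensional_def)
    moreover have "(\<lambda>i. if i \<in> insert j J then z i else y i) = ?w(j := z j)"
      by auto
    ultimately show ?case
      using upd[of ?w j "z j"] insert z by auto
  qed simp
  from this[OF \<open>finite I\<close> order_refl] have "F (\<lambda>i. if i \<in> I then z i else y i) = F y" .
  moreover have "(\<lambda>i. if i \<in> I then z i else y i) = z"
    using y z by (auto simp: PiE_iff extensional_def)
  ultimately show ?thesis by simp
qed

text \<open>\<open>S\<close> consists of two points on a line \<open>y(i := b)\<close> along which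
  \<open>F\<close> varies, and one further point \<open>z\<close>. One of the points on the line is
  taken at \<open>b = z i\<close>, so that \<open>z\<close> brings no third element into coordinate
  \<open>i\<close>.\<close>

lemma three_values_two_per_coordinate:
  assumes "finite I" and "card A \<ge> 3" and onto: "F ` (I \<rightarrow>\<^sub>E A) = A"
    and not_unary: "\<And>i. i \<in> I \<Longrightarrow> \<exists>y \<in> I \<rightarrow>\<^sub>E A. \<exists>z \<in> I \<rightarrow>\<^sub>E A. y i = z i \<and> F y \<noteq> F z"
  obtains S where "S \<subseteq> I \<rightarrow>\<^sub>E A" and "finite S" and "card (F ` S) = 3"
    and "\<And>j. j \<in> I \<Longrightarrow> card ((\<lambda>y. y j) ` S) \<le> 2"
proof -
  have third: "\<exists>c\<in>A. c \<noteq> a \<and> c \<noteq> b" for a b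
  proof (rule ccontr)
    assume "\<not> ?thesis"
    then have "A \<subseteq> {a, b}" by auto
    then have "card A \<le> card {a, b}" by (intro card_mono) auto
    also have "\<dots> \<le> 2" by (simp add: card_insert_if)
    finally show False using assms(2) by simp
  qed
  \<comment> \<open>Otherwise \<open>F\<close> would be constant, while its image \<open>A\<close>
    has more than one element.\<close>
  have "\<exists>y i a. y \<in> I \<rightarrow>\<^sub>E A \<and> i \<in> I \<and> a \<in> A \<and> F (y(i := a)) \<noteq> F y"
  proof (rule ccontr)
    assume "\<not> ?thesis"
    then have const: "F y = F z" if "y \<in> I \<rightarrow>\<^sub>E A" "z \<in> I \<rightarrow>\<^sub>E A" for y z
      using constant_if_independent_of_each_coordinate[OF \<open>finite I\<close>, of A F] that by blast
    obtain c d where "c \<in> F ` (I \<rightarrow>\<^sub>E A)" "d \<in> F ` (I \<rightarrow>\<^sub>E A)" "d \<noteq> c"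
      unfolding onto using third by blast
    then obtain y z where "y \<in> I \<rightarrow>\<^sub>E A" "z \<in> I \<rightarrow>\<^sub>E A" "F z \<noteq> F y"
      by (elim imageE) simp
    with const show False by blast
  qed
  then obtain y i a where y: "y \<in> I \<rightarrow>\<^sub>E A" and i: "i \<in> I" and a: "a \<in> A" "F (y(i := a)) \<noteq> F y"
    by blast
  have upd: "y(i := b) \<in> I \<rightarrow>\<^sub>E A" if "b \<in> A" for b
    using y i that by (auto simp: PiE_iff extensional_def)
  have yi: "y i \<in> A" using y i by auto
  obtain z c where z: "z \<in> I \<rightarrow>\<^sub>E A" and c: "c \<in> A"
    and ne: "F (y(i := z i)) \<noteq> F (y(i := c))" "F z \<noteq> F (y(i := z i))" "F z \<noteq> F (y(i := c))"
  proof (cases "\<exists>v\<in>A. \<forall>b\<in>A. F (y(i := b)) \<noteq> v")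
    \<comment> \<open>The line misses the value \<open>v\<close>. Any preimage \<open>z\<close> of
      \<open>v\<close> then differs in value from every point of the line. Since \<open>F\<close>
      takes different values at \<open>a\<close> and at \<open>y i\<close> on the line, one of these
      two can serve as \<open>c\<close>.\<close>
    case True
    then obtain v where v: "v \<in> A" "\<And>b. b \<in> A \<Longrightarrow> F (y(i := b)) \<noteq> v" by blast
    then have "v \<in> F ` (I \<rightarrow>\<^sub>E A)" unfolding onto by simp
    then obtain z where z: "z \<in> I \<rightarrow>\<^sub>E A" "v = F z" by (rule imageE)
    have zi: "z i \<in> A" using z(1) i by (rule PiE_mem)
    have "\<exists>c\<in>A. F (y(i := z i)) \<noteq> F (y(i := c))"
    proof (cases "F (y(i := z i)) = F y")
      case True
      then show ?thesis using a by (intro bexI[of _ a]) simp_all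
    next
      case False
      then show ?thesis using yi by (intro bexI[of _ "y i"]) simp_all
    qed
    then obtain c where "c \<in> A" "F (y(i := z i)) \<noteq> F (y(i := c))" by blast
    then show thesis
      using z(1) v(2)[OF zi] v(2)[of c] unfolding z(2) by (intro that[of z c]) simp_all
  next
    \<comment> \<open>The line attains every value. If \<open>F z\<close> always agreed with the
      value on the line at \<open>z i\<close>, then \<open>F\<close> would depend on coordinate
      \<open>i\<close> alone. So some \<open>z\<close> disagrees, and a third value is found on the
      line, at \<open>c\<close>.\<close>
    case False
    have "\<exists>z \<in> I \<rightarrow>\<^sub>E A. F z \<noteq> F (y(i := z i))"
    proof (rule ccontr)
      assume "\<not> ?thesis"
      then have "F z = F (y(i := z i))" if "z \<in> I \<rightarrow>\<^sub>E A" for z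
        using that by blast
      then show False using not_unary[OF i] by fastforce
    qed
    then obtain z where z: "z \<in> I \<rightarrow>\<^sub>E A" "F z \<noteq> F (y(i := z i))" by blast
    obtain v where v: "v \<in> A" "v \<noteq> F z" "v \<noteq> F (y(i := z i))" using third by blast
    obtain c where "c \<in> A" "F (y(i := c)) = v" using False v(1) by blast
    then show thesis using z v by (intro that[of z c]) simp_all
  qed
  have zi: "z i \<in> A" using z i by (rule PiE_mem)
  show thesis
  proof (rule that)
    show "{y(i := z i), y(i := c), z} \<subseteq> I \<rightarrow>\<^sub>E A"
      using upd[OF zi] upd[OF c] z by simp
    show "card (F ` {y(i := z i), y(i := c), z}) = 3"
      using ne by simp
    \<comment> \<open>The three points have entries \<open>z i\<close>, \<open>c\<close>,
      \<open>z i\<close> in coordinate \<open>i\<close>, and \<open>y j\<close>, \<open>y j\<close>,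
      \<open>z j\<close> in any other coordinate \<open>j\<close>.\<close>
    show "card ((\<lambda>y. y j) ` {y(i := z i), y(i := c), z}) \<le> 2" for j
      by (cases "j = i") (simp_all add: card_insert_if)
  qed simp
qed

text \<open>\<open>T\<close> adds to the three-valued set \<open>S\<close> one preimage of each
  value that \<open>F\<close> does not take on \<open>S\<close>. Then \<open>F\<close> is onto
  already on \<open>T\<close>, and \<open>T\<close> is too small to use all of \<open>A\<close> in
  any coordinate \<open>j\<close>, so an omitted element can be chosen as
  \<open>a j\<close>.\<close>

lemma yablonskii_onto_on_proper_box:
  assumes "finite I" and "card A \<ge> 3" and onto: "F ` (I \<rightarrow>\<^sub>E A) = A"
    and not_unary: "\<And>i. i \<in> I \<Longrightarrow> \<exists>y \<in> I \<rightarrow>\<^sub>E A. \<exists>z \<in> I \<rightarrow>\<^sub>E A. y i = z i \<and> F y \<noteq> F z"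
  obtains a where "a \<in> I \<rightarrow> A" and "A \<subseteq> F ` (\<Pi>\<^sub>E i\<in>I. A - {a i})"
proof -
  have fin: "finite A" using assms(2) by (metis card.infinite not_numeral_le_zero)
  obtain S where S: "S \<subseteq> I \<rightarrow>\<^sub>E A" "finite S" "card (F ` S) = 3"
      "\<And>j. j \<in> I \<Longrightarrow> card ((\<lambda>y. y j) ` S) \<le> 2"
    using three_values_two_per_coordinate[OF assms] by blast
  have FS: "F ` S \<subseteq> A" using S(1) onto by blast
  define t where "t = inv_into (I \<rightarrow>\<^sub>E A) F"
  have t: "t v \<in> I \<rightarrow>\<^sub>E A" "F (t v) = v" if "v \<in> A" for v
    using that onto inv_into_into[of v F "I \<rightarrow>\<^sub>E A"] f_inv_into_f[of v F "I \<rightarrow>\<^sub>E A"]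
    by (simp_all add: t_def)
  define R where "R = A - F ` S"
  have card_R: "card R = card A - 3"
    unfolding R_def using FS S(2,3) by (simp add: card_Diff_subset)
  define T where "T = S \<union> t ` R"
  have T: "T \<subseteq> I \<rightarrow>\<^sub>E A"
    unfolding T_def R_def using S(1) t(1) by blast
  have FT: "A \<subseteq> F ` T"
  proof
    fix v assume "v \<in> A"
    show "v \<in> F ` T"
    proof (cases "v \<in> F ` S")
      case False
      then have "t v \<in> T" using \<open>v \<in> A\<close> by (simp add: T_def R_def)
      then show ?thesis using t(2)[OF \<open>v \<in> A\<close>] by (metis image_eqI)
    qed (auto simp: T_def)
  qed
  have "\<exists>b. b \<in> A \<and> b \<notin> (\<lambda>y. y j) ` T" if j: "j \<in> I" for j
  proof (rule ccontr)
    assume "\<not> ?thesis"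
    then have "A \<subseteq> (\<lambda>y. y j) ` S \<union> (\<lambda>v. t v j) ` R"
      unfolding T_def by blast
    moreover have "finite ((\<lambda>y. y j) ` S \<union> (\<lambda>v. t v j) ` R)"
      using S(2) fin by (simp add: R_def)
    ultimately have "card A \<le> card ((\<lambda>y. y j) ` S \<union> (\<lambda>v. t v j) ` R)"
      by (rule card_mono[rotated])
    also have "\<dots> \<le> card ((\<lambda>y. y j) ` S) + card ((\<lambda>v. t v j) ` R)"
      by (rule card_Un_le)
    \<comment> \<open>As \<open>card A\<close> is at least 3, the subtraction is not truncated and
      the bound equals \<open>card A - 1\<close>.\<close>
    also have "\<dots> \<le> 2 + (card A - 3)"
      using S(4)[OF j] card_image_le[of R "\<lambda>v. t v j"] fin card_R
      by (intro add_mono) (auto simp: R_def)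
    finally show False using assms(2) by simp
  qed
  then have "\<forall>j\<in>I. \<exists>b. b \<in> A \<and> b \<notin> (\<lambda>y. y j) ` T" by (rule ballI)
  then obtain a where a: "\<forall>j\<in>I. a j \<in> A \<and> a j \<notin> (\<lambda>y. y j) ` T"
    by (elim bchoice[elim_format] exE)
  have "T \<subseteq> (\<Pi>\<^sub>E i\<in>I. A - {a i})"
  proof
    fix y assume y: "y \<in> T"
    with T have "y \<in> I \<rightarrow>\<^sub>E A" by blast
    moreover have "y j \<noteq> a j" if "j \<in> I" for j
      using bspec[OF a that] imageI[OF y, of "\<lambda>y. y j"] by auto
    ultimately show "y \<in> (\<Pi>\<^sub>E i\<in>I. A - {a i})" by (auto simp: PiE_iff)
  qed
  with FT have "A \<subseteq> F ` (\<Pi>\<^sub>E i\<in>I. A - {a i})" by blast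
  moreover have "a \<in> I \<rightarrow> A" using a by blast
  ultimately show thesis by (rule that[rotated])
qed

text \<open>This is the universal property of the product. Well-formedness of \<open>K\<close> makes
  the ends of an arc vertices, so that their images are tuples over \<open>G\<close>, as the arcs of
  \<open>dg_power\<close> require.\<close>

lemma dg_hom_tuple:
  assumes "\<And>i. i < k \<Longrightarrow> dg_hom K G (g i)" and "wf_digraph (with_proj K)"
  shows "dg_hom K (dg_power G k) (\<lambda>x. \<lambda>i\<in>{..<k}. g i x)"
proof -
  have "x \<in> pverts K" "y \<in> pverts K" if "(x, y) \<in> parcs K" for x y
    using wf_digraph.wellformed[OF assms(2), of "(x, y)"] that by simp_all
  moreover have "g i x \<in> pverts G" if "i < k" "x \<in> pverts K" for i x
    using assms(1) that by (auto simp: dg_hom_def)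
  moreover have "(g i x, g i y) \<in> parcs G" if "i < k" "(x, y) \<in> parcs K" for i x y
    using assms(1)[OF that(1)] that(2) by (auto simp: dg_hom_def)
  ultimately show ?thesis
    by (auto simp: dg_hom_def dg_power_def)
qed

lemma dg_hom_compose:
  assumes "dg_hom K H g" and "dg_hom H G h"
  shows "dg_hom K G (\<lambda>x. h (g x))"
  using assms unfolding dg_hom_def by fast

lemma polymorphism_preserves_pp_defined:
  assumes F: "polymorphism G k F" and K: "wf_digraph (with_proj K)"
  shows "F ` (\<Pi>\<^sub>E i\<in>{..<k}. pp_defined G K xs (f i) u)
    \<subseteq> pp_defined G K xs (\<lambda>x. F (\<lambda>i\<in>{..<k}. f i x)) u"
proof (rule image_subsetI)
  fix y assume y: "y \<in> (\<Pi>\<^sub>E i\<in>{..<k}. pp_defined G K xs (f i) u)"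
  then have "\<forall>i\<in>{..<k}. \<exists>g. y i = g u \<and> dg_hom K G g \<and> (\<forall>x\<in>set xs. g x = f i x)"
    by (auto simp: pp_defined_def PiE_iff)
  then obtain g where
    "\<forall>i\<in>{..<k}. y i = g i u \<and> dg_hom K G (g i) \<and> (\<forall>x\<in>set xs. g i x = f i x)"
    by (elim bchoice[elim_format] exE)
  then have g: "y i = g i u" "dg_hom K G (g i)" "\<And>x. x \<in> set xs \<Longrightarrow> g i x = f i x"
    if "i < k" for i
    using that by auto
  let ?g = "\<lambda>x. F (\<lambda>i\<in>{..<k}. g i x)"
  have "dg_hom K G ?g"
    using dg_hom_tuple[OF g(2) K] F unfolding polymorphism_def by (rule dg_hom_compose)
  moreover have "?g x = F (\<lambda>i\<in>{..<k}. f i x)" if "x \<in> set xs" for x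
    using g(3) that by (intro arg_cong[where f = F] restrict_ext) simp
  \<comment> \<open>Tuples are extensional, so agreement below \<open>k\<close> gives equality, and
    hence \<open>F y\<close> is the value of \<open>?g\<close> at \<open>u\<close>.\<close>
  moreover have "y = (\<lambda>i\<in>{..<k}. g i u)"
    using y g(1) by (intro extensionalityI[of _ "{..<k}"]) (auto simp: PiE_iff)
  ultimately show "F y \<in> pp_defined G K xs (\<lambda>x. F (\<lambda>i\<in>{..<k}. f i x)) u"
    unfolding pp_defined_def by (intro CollectI exI[of _ ?g]) simp
qed

text \<open>The unary map is \<open>F\<close> restricted to the diagonal: the constant tuple with
  entry \<open>y i\<close> agrees with \<open>y\<close> in coordinate \<open>i\<close>. It is a
  homomorphism because the diagonal is a tuple of identity maps.\<close>

lemma essentially_unary_if_determined_by_coordinate: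
  assumes G: "wf_digraph (with_proj G)" and F: "polymorphism G k F" and "i < k"
    and det: "\<And>y z. y \<in> pverts (dg_power G k) \<Longrightarrow> z \<in> pverts (dg_power G k) \<Longrightarrow> y i = z i \<Longrightarrow> F y = F z"
  shows "essentially_unary G k F"
proof -
  let ?h = "\<lambda>a. F (\<lambda>j\<in>{..<k}. a)"
  have "dg_hom G G (\<lambda>a. a)" by (auto simp: dg_hom_def)
  then have "dg_hom G G ?h"
    using dg_hom_compose[OF dg_hom_tuple[OF _ G], of k G "\<lambda>_ a. a" G F] F
    unfolding polymorphism_def by simp
  moreover have "F y = ?h (y i)" if "y \<in> pverts (dg_power G k)" for y
    using that \<open>i < k\<close> by (intro det) (auto simp: dg_power_def)
  ultimately show ?thesis
    unfolding essentially_unary_def using \<open>i < k\<close> by blast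
qed

theorem theorem4p4:
  fixes G :: "'a pair_pre_digraph" and K :: "'b pair_pre_digraph"
    and xs :: "'b list" and u :: 'b
  assumes "reflexive_digraph G" and "card (pverts G) \<noteq> 2"
    and "reflexive_digraph K" and "set xs \<subseteq> pverts K" and "u \<in> pverts K"
    and "\<forall>a \<in> pverts G. \<exists>f \<in> set xs \<rightarrow> pverts G. pp_defined G K xs f u = pverts G - {a}"
    and "\<forall>f \<in> set xs \<rightarrow> pverts G. pp_defined G K xs f u \<subset> pverts G"
  shows "slupecki G"
  unfolding slupecki_def
proof (intro allI impI, elim conjE)
  fix k :: nat and F
  assume k: "2 \<le> k" and F: "polymorphism G k F"
    and onto: "F ` pverts (dg_power G k) = pverts G"
  interpret G: reflexive_digraph G by fact
  interpret K: reflexive_digraph K by fact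
  have V: "pverts (dg_power G k) = {..<k} \<rightarrow>\<^sub>E pverts G" by (simp add: dg_power_def)
  show "essentially_unary G k F"
  proof (rule ccontr)
    assume "\<not> essentially_unary G k F"
    then have dep: "\<exists>y \<in> {..<k} \<rightarrow>\<^sub>E pverts G. \<exists>z \<in> {..<k} \<rightarrow>\<^sub>E pverts G. y i = z i \<and> F y \<noteq> F z"
      if "i \<in> {..<k}" for i
      using essentially_unary_if_determined_by_coordinate[OF G.wf_digraph F, of i] that
      unfolding V by blast
    \<comment> \<open>With at most one vertex all values of \<open>F\<close> coincide, against
      \<open>dep\<close> at coordinate 0. As two vertices are excluded by hypothesis, at least three
      remain.\<close>
    have "\<not> card (pverts G) \<le> 1"
    proof
      assume "card (pverts G) \<le> 1"
      then have "a = b" if "a \<in> pverts G" "b \<in> pverts G" for a b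
        using that card_le_Suc0_iff_eq[OF G.finite_verts] by simp
      moreover obtain y z where "y \<in> {..<k} \<rightarrow>\<^sub>E pverts G" "z \<in> {..<k} \<rightarrow>\<^sub>E pverts G" "F y \<noteq> F z"
        using dep[of 0] k by auto
      ultimately show False using onto unfolding V by blast
    qed
    then have "card (pverts G) \<ge> 3" using assms(2) by linarith
    then obtain a where a: "a \<in> {..<k} \<rightarrow> pverts G"
        and box: "pverts G \<subseteq> F ` (\<Pi>\<^sub>E i\<in>{..<k}. pverts G - {a i})"
      by (rule yablonskii_onto_on_proper_box[OF finite_lessThan _ onto[unfolded V] dep])
    have "\<forall>i\<in>{..<k}. \<exists>f \<in> set xs \<rightarrow> pverts G. pp_defined G K xs f u = pverts G - {a i}"
      using a assms(6) by blast
    then obtain f where "\<forall>i\<in>{..<k}.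
        f i \<in> set xs \<rightarrow> pverts G \<and> pp_defined G K xs (f i) u = pverts G - {a i}"
      unfolding Bex_def by (elim bchoice[elim_format] exE)
    then have f: "f i \<in> set xs \<rightarrow> pverts G" "pp_defined G K xs (f i) u = pverts G - {a i}"
      if "i \<in> {..<k}" for i
      using that by blast+
    let ?f = "\<lambda>x. F (\<lambda>i\<in>{..<k}. f i x)"
    have "(\<Pi>\<^sub>E i\<in>{..<k}. pp_defined G K xs (f i) u) = (\<Pi>\<^sub>E i\<in>{..<k}. pverts G - {a i})"
      using f(2) by (rule PiE_cong)
    then have "pverts G \<subseteq> pp_defined G K xs ?f u"
      using polymorphism_preserves_pp_defined[OF F K.wf_digraph, of xs f u] box by auto
    \<comment> \<open>This makes \<open>?f\<close> an admissible map for the hypothesis that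
      pp-defined sets are proper, which the inclusion just shown contradicts.\<close>
    moreover have "?f \<in> set xs \<rightarrow> pverts G"
    proof
      fix x assume "x \<in> set xs"
      then have "(\<lambda>i\<in>{..<k}. f i x) \<in> {..<k} \<rightarrow>\<^sub>E pverts G" 
        using funcset_mem[OF f(1)] by auto
      then show "?f x \<in> pverts G" using onto unfolding V by blast
    qed
    ultimately show False using assms(7) by blast
  qed
qed

end
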